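(* Let $n$ be a positive integer with $n\equiv 5$ or $7\pmod{8}$. Then \[ \sum_{k=0}^{(n-1)/2}[10k+2] \frac{(q;q)_{2k}\,(q;q^2)_{3k}\,(q^2;q^8)_k} {(q^9, q^8;q^8)_k\,(q;q^2)_{2k}\,(q^5;q^4)_k\,(q^2;q^2)_k}\,q^{2k} \equiv 0\pmod{\Phi_n(q)}. \]
   Context: Here $q$ is an indeterminate. For $x$ and a base $p$ (a power of $q$), $(x;p)_k=\prod_{j=0}^{k-1}(1-xp^j)$ and $(x_1,x_2;p)_k=(x_1;p)_k(x_2;p)_k$. The $q$-integer is $[j]=1+q+\cdots+q^{j-1}$ and $\Phi_n(q)$ is the $n$-th cyclotomic polynomial. For rational functions $A(q),B(q)$ and a polynomial $P(q)$, $A\equiv B\pmod{P}$ means that the numerator of the reduced form of $A-B$ is divisible by $P$ in $\mathbb{Z}[q]$. *)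

theory Defs
  imports Complex_Main "HOL-Computational_Algebra.Computational_Algebra"
begin

definition primitive_roots_unity :: "nat \<Rightarrow> complex set" where
  "primitive_roots_unity n = {z. z ^ n = 1 \<and> (\<forall>m\<in>{0<..<n}. z ^ m \<noteq> 1)}"

text \<open>
  The polynomial over \<open>\<int>\<close> whose image over \<open>\<complex>\<close> is the product of the \<open>X - z\<close>
  over the primitive \<open>n\<close>-th roots of unity \<open>z\<close>.
  For \<open>n > 0\<close>, existence and uniqueness are established in \<open>of_int_cyclotomic\<close> below.
\<close>
definition cyclotomic :: "nat \<Rightarrow> int poly" where
  "cyclotomic n = (THE p. map_poly of_int p = (\<Prod>z\<in>primitive_roots_unity n. [:- z, 1:]))"

lemma map_poly_of_int_mult:
  "map_poly of_int (p * q) = (map_poly of_int p * map_poly of_int q :: complex poly)"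
  by (rule poly_eqI) (simp add: coeff_map_poly coeff_mult)

lemma map_poly_of_int_add:
  "map_poly of_int (p + q) = (map_poly of_int p + map_poly of_int q :: complex poly)"
  by (rule poly_eqI) (simp add: coeff_map_poly)

lemma map_poly_of_int_prod:
  "map_poly of_int (prod f A) = (\<Prod>x\<in>A. map_poly of_int (f x) :: complex poly)"
  by (induction A rule: infinite_finite_induct) (simp_all add: map_poly_of_int_mult map_poly_1)

lemma inj_map_poly_of_int: "inj (map_poly of_int :: int poly \<Rightarrow> complex poly)"
  by (rule injI) (metis coeff_map_poly of_int_0 of_int_eq_iff poly_eqI)

lemma primitive_roots_unity_partition:
  assumes "n > 0"
  shows "{z::complex. z ^ n = 1} = (\<Union>d\<in>{d. d dvd n}. primitive_roots_unity d)"
proof (intro equalityI subsetI)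
  fix z :: complex assume z: "z \<in> {z. z ^ n = 1}"
  define d where "d = (LEAST m. m > 0 \<and> z ^ m = 1)"
  have d: "d > 0" "z ^ d = 1"
    using LeastI[of "\<lambda>m. m > 0 \<and> z ^ m = 1" n] z assms unfolding d_def by auto
  have min: "z ^ m \<noteq> 1" if "m > 0" "m < d" for m
    using not_less_Least[of m "\<lambda>m. m > 0 \<and> z ^ m = 1"] that unfolding d_def by auto
  have "z ^ n = z ^ (d * (n div d) + n mod d)" by simp
  also have "\<dots> = z ^ (n mod d)" 
    using d(2) by (simp only: power_add power_mult power_one mult_1_left)
  finally have "z ^ (n mod d) = 1" using z by simp
  hence "n mod d = 0" using min[of "n mod d"] d(1) by auto
  thus "z \<in> (\<Union>d\<in>{d. d dvd n}. primitive_roots_unity d)"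
    using d(2) min by (auto simp: primitive_roots_unity_def)
qed (auto simp: primitive_roots_unity_def power_mult elim!: dvdE)

lemma disjoint_primitive_roots_unity:
  assumes "d > 0" "e > 0" "d \<noteq> e"
  shows "primitive_roots_unity d \<inter> primitive_roots_unity e = {}"
  using assms unfolding primitive_roots_unity_def
  by (cases d e rule: linorder_cases) auto

lemma finite_primitive_roots_unity: "d > 0 \<Longrightarrow> finite (primitive_roots_unity d)"
  by (rule finite_subset[OF _ finite_roots_unity[of d]]) (auto simp: primitive_roots_unity_def)

lemma prod_linear_roots_unity:
  assumes "n > 0"
  shows "(\<Prod>z | z ^ n = 1. [:- z, 1:]) = (monom 1 n - 1 :: complex poly)" (is "?P = ?Q")
proof (rule ccontr)
  assume "?P \<noteq> ?Q"
  let ?D = "?P - ?Q" and ?A = "{z::complex. z ^ n = 1}"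
  have D0: "?D \<noteq> 0" using \<open>?P \<noteq> ?Q\<close> by simp
  have fin: "finite ?A" and card: "card ?A = n"
    using assms by (auto intro: finite_roots_unity card_roots_unity_eq)
  have degP: "degree ?P = n" by (simp add: degree_prod_eq_sum_degree card)
  have degQ: "degree ?Q = n"
    using assms by (simp add: degree_monom_eq diff_conv_add_uminus degree_add_eq_left del: add_uminus_conv_diff)
  have "lead_coeff ?P = 1" by (simp add: lead_coeff_prod)
  hence "coeff ?D n = 0" using assms degP by simp
  have "degree ?D \<le> n" using degree_diff_le[of ?P n ?Q] degP degQ by linarith
  moreover have "degree ?D \<noteq> n"
    using \<open>coeff ?D n = 0\<close> D0 by (metis leading_coeff_0_iff)
  ultimately have "degree ?D < n" by simp
  have "?A \<subseteq> {z. poly ?D z = 0}"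
    using fin by (auto simp: poly_prod poly_monom prod_zero_iff)
  hence "n \<le> card {z. poly ?D z = 0}"
    using card_mono[OF poly_roots_finite[OF D0]] card by metis
  also have "\<dots> \<le> degree ?D" by (rule card_poly_roots_bound[OF D0])
  finally show False using \<open>degree ?D < n\<close> by simp
qed

lemma int_poly_dvd_of_int:
  fixes F G :: "int poly" and C :: "complex poly"
  assumes "map_poly of_int F = C * map_poly of_int G" "lead_coeff G = 1"
  shows "\<exists>S. map_poly of_int S = C"
proof -
  let ?h = "map_poly of_int :: int poly \<Rightarrow> complex poly"
  have G0: "G \<noteq> 0" using assms(2) by auto
  obtain S R where "pseudo_divmod F G = (S, R)" by fastforce
  from pseudo_divmod[OF G0 this] assms(2)
  have SR: "F = G * S + R" "R = 0 \<or> degree R < degree G" by auto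
  have eq: "(C - ?h S) * ?h G = ?h R"
    using assms(1) unfolding SR(1)
    by (simp add: map_poly_of_int_mult map_poly_of_int_add algebra_simps)
  have deg: "degree (?h p) = degree p" for p by (rule degree_map_poly) auto
  have hG0: "?h G \<noteq> 0" using G0 inj_map_poly_of_int by (metis injD map_poly_0)
  have "C - ?h S = 0"
  proof (rule ccontr)
    assume nz: "C - ?h S \<noteq> 0"
    hence "?h R \<noteq> 0" using eq hG0 by (metis mult_eq_0_iff)
    moreover have "degree (?h R) \<ge> degree (?h G)"
      using degree_mult_eq[OF nz hG0] eq by simp
    ultimately show False using SR(2) by (auto simp: deg)
  qed
  thus ?thesis by auto
qed

lemma cyclotomic_exists:
  assumes "n > 0"
  shows "\<exists>p::int poly. map_poly of_int p = (\<Prod>z\<in>primitive_roots_unity n. [:- z, 1:])"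
  using assms
proof (induction n rule: less_induct)
  case (less n)
  let ?h = "map_poly of_int :: int poly \<Rightarrow> complex poly"
  let ?C = "\<lambda>d. \<Prod>z\<in>primitive_roots_unity d. [:- z, 1:]"
  let ?D = "{d. d dvd n}"
  have finD: "finite ?D" using less.prems by auto
  have pos: "d > 0" if "d dvd n" for d using that less.prems by (auto intro: Nat.gr0I)
  have "\<exists>p. ?h p = ?C d" if "d \<in> ?D - {n}" for d
    using that less.prems by (intro less.IH) (auto dest: dvd_imp_le intro: pos le_neq_implies_less)
  then obtain f where f: "\<And>d. d \<in> ?D - {n} \<Longrightarrow> ?h (f d) = ?C d" by metis
  define G where "G = prod f (?D - {n})"
  have hG: "?h G = prod ?C (?D - {n})"
    unfolding G_def map_poly_of_int_prod using f by (intro prod.cong) auto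
  have "?h (monom 1 n - 1) = monom 1 n - 1"
    by (rule poly_eqI) (simp add: coeff_map_poly coeff_1 flip: one_poly_def)
  also have "\<dots> = prod ?C ?D"
    unfolding prod_linear_roots_unity[OF less.prems, symmetric]
      primitive_roots_unity_partition[OF less.prems]
    using finD
    by (intro prod.UNION_disjoint)
      (simp_all add: finite_primitive_roots_unity disjoint_primitive_roots_unity pos)
  also have "\<dots> = ?C n * ?h G"
    unfolding hG using finD by (intro prod.remove) auto
  finally have eq: "?h (monom 1 n - 1) = ?C n * ?h G" .
  have "lead_coeff (?h G) = 1" unfolding hG by (simp add: lead_coeff_prod)
  moreover have "degree (?h G) = degree G" by (rule degree_map_poly) auto
  ultimately have "lead_coeff G = 1" by (simp add: coeff_map_poly)
  from int_poly_dvd_of_int[OF eq this] show ?case .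
qed

lemma of_int_cyclotomic:
  assumes "n > 0"
  shows "map_poly of_int (cyclotomic n) = (\<Prod>z\<in>primitive_roots_unity n. [:- z, 1:])"
proof -
  obtain p :: "int poly" where p: "map_poly of_int p = (\<Prod>z\<in>primitive_roots_unity n. [:- z, 1:])"
    using cyclotomic_exists[OF assms] by blast
  show ?thesis unfolding cyclotomic_def
    by (rule theI[of _ p], rule p) (simp add: p injD[OF inj_map_poly_of_int])
qed


text \<open>
  Rational functions in \<open>q\<close> are the elements of the fraction field of \<open>\<int>[q]\<close>;
  the indeterminate itself is written \<open>\<q>\<close>.
\<close>
definition q_indet :: "int poly fract" ("\<q>") where
  "\<q> = to_fract [:0, 1:]"

definition q_int :: "nat \<Rightarrow> int poly fract" where
  "q_int j = (\<Sum>i<j. \<q> ^ i)"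

definition qpoch :: "'a::comm_ring_1 \<Rightarrow> 'a \<Rightarrow> nat \<Rightarrow> 'a" where
  "qpoch x p k = (\<Prod>j<k. 1 - x * p ^ j)"

definition qpoch2 :: "'a::comm_ring_1 \<Rightarrow> 'a \<Rightarrow> 'a \<Rightarrow> nat \<Rightarrow> 'a" where
  "qpoch2 x y p k = qpoch x p k * qpoch y p k"

text \<open>
  The function \<open>quot_of_fract\<close> yields numerator and denominator in lowest terms over
  \<open>\<int>[q]\<close>, integer content included.
\<close>
definition ratfun_cong :: "int poly fract \<Rightarrow> int poly fract \<Rightarrow> int poly \<Rightarrow> bool" where
  "ratfun_cong A B P \<longleftrightarrow> P dvd fst (quot_of_fract (A - B))"

end

theory Submission
  imports Defs
begin

text \<open>
  Put \<open>p = q\<^sup>2\<close>. The summand is, up to the factor \<open>1 - q\<close>, the case \<open>a = p\<close>, \<open>b = q\<close> of the summand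
  of the Gasper--Rahman quartic sum with base \<open>p\<close>, and for \<open>a = w\<^sup>2\<close>, \<open>b = p / w\<close> it can be written
  without removable singularities (\<open>regular_term w p\<close>). A primitive \<open>n\<close>-th root of unity \<open>\<zeta>\<close>
  satisfies \<open>\<zeta> = (\<zeta>\<^sup>2)\<^bsup>N+1\<^esup>\<close> with \<open>N = (n - 1) / 2\<close>, so the value at \<open>q = \<zeta>\<close> is the limit of the sum with
  \<open>w = p\<^bsup>N+1\<^esup>\<close> as \<open>p \<rightarrow> \<zeta>\<^sup>2\<close>. That sum has \<open>b = p\<^bsup>-N\<^esup>\<close> and terminates. For terminating sums the
  replacement of \<open>(a, b)\<close> by \<open>(a / p, b / p)\<close> multiplies the sum by an explicit rational factor
  (by a WZ certificate), and at \<open>a = p\<^bsup>2N+2\<^esup>\<close> one of the resulting factors vanishes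
  while none has a pole, as long as \<open>4\<close> does not divide \<open>N\<close>.
\<close>

subsection \<open>A contiguous relation for the quartic sum\<close>

lemma qpoch_0 [simp]: "qpoch x p 0 = 1"
  by (simp add: qpoch_def)

lemma qpoch_Suc: "qpoch x p (Suc k) = qpoch x p k * (1 - x * p ^ k)"
  by (simp add: qpoch_def)

lemma qpoch_Suc_shift: "qpoch x p (Suc k) = (1 - x) * qpoch (x * p) p k"
  by (simp add: qpoch_def prod.lessThan_Suc_shift mult.assoc del: prod.lessThan_Suc)

lemma qpoch_eq_0_iff: "qpoch x p k = 0 \<longleftrightarrow> (\<exists>j<k. x * p ^ j = (1 :: 'a :: field))"
  by (auto simp: qpoch_def prod_zero_iff)

text \<open>The value at \<open>k = 0\<close> is \<open>1 - a\<close>: the customary normalization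
  by \<open>1 - a\<close> is omitted. The numerator factor with base \<open>q ^ 2\<close> is what
  \<open>(a^2 b^2/q^2; q^4)_k / (a b/q; q^2)_k\<close> becomes after cancellation.\<close>

definition quartic_term :: "'a::field \<Rightarrow> 'a \<Rightarrow> 'a \<Rightarrow> nat \<Rightarrow> 'a" where
  "quartic_term a b q k =
    (1 - a * q ^ (5 * k)) * qpoch a q k * qpoch b q k * qpoch (q / b) q (3 * k)
      * qpoch (- (a * b / q)) (q ^ 2) k * q ^ k
    / (qpoch (q ^ 4) (q ^ 4) k * qpoch (a * q ^ 4 / b) (q ^ 4) k
      * qpoch (q ^ 3 / (a * b ^ 2)) q k * qpoch (a * b) q (2 * k))"

text \<open>The factor that carries a terminating sum at \<open>(q * A, q * B)\<close> to the one at
  \<open>(A, B)\<close>.\<close>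

definition quartic_ratio :: "'a::field \<Rightarrow> 'a \<Rightarrow> 'a \<Rightarrow> 'a" where
  "quartic_ratio A B q =
    (1 - A) * (1 - A * B ^ 2) * (q - A * B ^ 2) * (q ^ 2 - A * B ^ 2)
    / ((1 - A * B) * (1 - q * A * B) * (q - A * B) * (q ^ 2 - A * B ^ 3))"

text \<open>
  The WZ certificate is taken at index \<open>m + 1\<close> so that, for \<open>b = q\<^bsup>-M\<^esup>\<close>,
  no denominator vanishes at the end of the summation range.
\<close>
definition quartic_cert :: "'a::field \<Rightarrow> 'a \<Rightarrow> 'a \<Rightarrow> nat \<Rightarrow> 'a" where
  "quartic_cert A B q m =
    - (A * B ^ 2) * (1 - A) * (1 - B)
      * qpoch (q * A) q m * qpoch (q * B) q m * qpoch (q / B) q (3 * m + 2)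
      * qpoch (- (q * A * B)) (q ^ 2) m * (q - A ^ 2 * B ^ 3 * q ^ m)
    / ((1 - A * B) * (1 - q * A * B) * (q - A * B) * (q ^ 2 - A * B ^ 3)
      * qpoch (q ^ 4) (q ^ 4) m * qpoch (A * q ^ 4 / B) (q ^ 4) m
      * qpoch (q ^ 3 / (A * B ^ 2)) q m * qpoch (q ^ 2 * A * B) q (2 * m))"

text \<open>The WZ equation with the common factor of its four members removed; \<open>x\<close>
  stands for \<open>q ^ (m + 1)\<close>. The left side comes from the two summands, the right side
  from two consecutive certificate values.\<close>

lemma certificate_identity:
  fixes A B q x :: "'a::idom"
  shows "x*(1-q*A*x^5)*(A*B^2-x)*(A*B^2-q*x)*(A*B^2-q^2*x)*(1-A*x)*(1-B*x)*(q+A*B*x^2)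
    - x*(1-A*x^5)*(q^2-A^2*B^2)*(q^2-A*B^3)*(1-A*B*x^2)*(1-q*A*B*x^2)*(B-x^3)
  = (q^2-A^2*B^3*x)*(1-x^4)*(B-A*x^4)*(A*B^2-q^2*x)*(1-A*B*x^2)*(1-q*A*B*x^2)
    -A*(B-q*x^3)*(B-q^2*x^3)*(B-x^3)*(q-A^2*B^3*x)*(1-A*x)*(1-B*x)*(q+A*B*x^2)"
  by algebra

definition quartic_generic :: "'a::field \<Rightarrow> 'a \<Rightarrow> 'a \<Rightarrow> bool" where
  "quartic_generic A B q \<longleftrightarrow> A \<noteq> 0 \<and> B \<noteq> 0 \<and> q \<noteq> 0 \<and> (\<forall>j>0. q ^ j \<noteq> 1) \<and> (\<forall>j. A * q ^ j \<noteq> B)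
     \<and> (\<forall>j. A * B ^ 2 \<noteq> q ^ j) \<and> (\<forall>j. A * B * q ^ j \<noteq> 1) \<and> A * B \<noteq> q \<and> A * B ^ 3 \<noteq> q ^ 2"

text \<open>Start of the telescoping. Continued back to \<open>x = 1\<close>, the certificate
  vanishes through its factor \<open>1 - x ^ 4\<close>, so the first difference alone has to equal
  the certificate at 0.\<close>

lemma quartic_cert_0:
  assumes "quartic_generic A B q"
  shows "quartic_ratio A B q * quartic_term (q * A) (q * B) q 0 - quartic_term A B q 0 = quartic_cert A B q 0"
proof -
  have nz: "A \<noteq> 0" "B \<noteq> 0" "q \<noteq> 0" "1 - A * B \<noteq> 0" "1 - q * A * B \<noteq> 0" "q - A * B \<noteq> 0" "q^2 - A * B ^ 3 \<noteq> 0"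
    using assms unfolding quartic_generic_def
    by (auto simp: mult_ac) (metis mult.right_neutral power_0, metis mult.left_commute power_one_right)
  have q3: "qpoch (q / B) q (Suc (Suc 0)) = (1 - q / B) * (1 - q * q / B)"
    by (simp add: qpoch_def)
  define E where "E = (1 - A * B) * (1 - q * A * B) * (q - A * B) * (q ^ 2 - A * B ^ 3)"
  have E: "E \<noteq> 0" using nz by (simp add: E_def)
  have 1: "quartic_ratio A B q * quartic_term (q * A) (q * B) q 0 - quartic_term A B q 0 =
     ((1 - A) * (1 - A * B ^ 2) * (q - A * B ^ 2) * (q ^ 2 - A * B ^ 2) * (1 - q * A) - (1 - A) * E) / E"
    using E by (simp add: quartic_ratio_def quartic_term_def diff_divide_distrib flip: E_def)
  have 2: "quartic_cert A B q 0 = - A * (1 - A) * (1 - B) * (B - q) * (B - q^2) * (q - A^2 * B^3) / E"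
  proof -
    have "quartic_cert A B q 0 = - (A * (1 - A) * (1 - B)) * (B^2 * ((1 - q / B) * (1 - q * q / B))) * (q - A^2 * B^3) / E"
      by (simp add: quartic_cert_def q3 flip: E_def)
    also have "B^2 * ((1 - q / B) * (1 - q * q / B)) = (B - q) * (B - q^2)"
      using nz by (simp add: field_simps power2_eq_square)
    finally show ?thesis by (simp add: mult_ac)
  qed
  \<comment> \<open>This is \<open>certificate_identity\<close> at \<open>x = 1\<close> without the
    common factor \<open>- (1 - B) * (q + A * B)\<close>. That factor may be zero, so the reduced
    identity is proved directly.\<close>
  have "(1 - A) * (1 - A * B ^ 2) * (q - A * B ^ 2) * (q ^ 2 - A * B ^ 2) * (1 - q * A) - (1 - A) * E = - A * (1 - A) * (1 - B) * (B - q) * (B - q^2) * (q - A^2 * B^3)"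
    unfolding E_def by algebra
  thus ?thesis unfolding 1 2 by simp
qed


text \<open>Serves to rewrite the reciprocal of a product at one index or starting point over the
  denominators \<open>D1\<close> to \<open>D4\<close> and \<open>E\<close> used below.\<close>

lemma inverse_eq_of_mult_eq:
  assumes "a * y = b * d" "y \<noteq> 0" "b \<noteq> (0 :: 'a :: field)"
  shows "inverse a = y * inverse b * inverse d"
proof -
  have "inverse (a * y) = inverse (b * d)" by (simp add: assms(1))
  hence "inverse a * inverse y = inverse b * inverse d" by simp
  hence "inverse a * (inverse y * y) = y * inverse b * inverse d" by (metis mult.assoc mult.commute)
  thus ?thesis using assms by simp
qed

text \<open>All four quantities become one factor \<open>Z\<close> times a polynomial in
  \<open>x = q ^ (m + 1)\<close>: denominators are raised to index \<open>m + 1\<close>, numerator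
  products stripped down to index \<open>m\<close>. \<open>certificate_identity\<close> then
  compares the polynomials.\<close>

lemma quartic_cert_Suc:
  assumes gen: "quartic_generic A B q"
  shows "quartic_cert A B q m + (quartic_ratio A B q * quartic_term (q * A) (q * B) q (Suc m) - quartic_term A B q (Suc m))
    = quartic_cert A B q (Suc m)"
proof -
  have nz: "A \<noteq> 0" "B \<noteq> 0" "q \<noteq> 0" "1 - A * B \<noteq> 0" "1 - q * A * B \<noteq> 0" "q - A * B \<noteq> 0" "q^2 - A * B ^ 3 \<noteq> 0"
    using gen unfolding quartic_generic_def
    by (auto simp: mult_ac) (metis mult.right_neutral power_0, metis mult.left_commute power_one_right)
  have AB2: "A * B ^ 2 \<noteq> q ^ j" for j using gen by (simp add: quartic_generic_def)
  have genD: "\<And>j. 0 < j \<Longrightarrow> q ^ j \<noteq> 1" "\<And>j. A * q ^ j \<noteq> B" "\<And>j. A * B * q ^ j \<noteq> 1"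
    using gen by (simp_all add: quartic_generic_def)
  define x where "x = q ^ Suc m"
  define c where "c = 1 / (A * B ^ 2)"
  have c_ne: "1 - c * q ^ j \<noteq> 0" for j
    using AB2[of j] nz unfolding c_def by (auto simp: field_simps)
  define E where "E = (1 - A * B) * (1 - q * A * B) * (q - A * B) * (q ^ 2 - A * B ^ 3)"
  have E: "E \<noteq> 0" using nz by (simp add: E_def)
  define D1 where "D1 = qpoch (q ^ 4) (q ^ 4) (Suc m)"
  define D2 where "D2 = qpoch (A * q ^ 4 / B) (q ^ 4) (Suc m)"
  define D3 where "D3 = qpoch (q ^ 3 * c) q (Suc m)"
  define D4 where "D4 = qpoch (q ^ 2 * A * B) q (2 * Suc m)"
  define Pa where "Pa = qpoch (q * A) q m"
  define Pb where "Pb = qpoch (q * B) q m"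
  define P3 where "P3 = qpoch (q / B) q (3 * m + 2)"
  define Pm where "Pm = qpoch (- (q * A * B)) (q ^ 2) m"
  define Z where "Z = Pa * Pb * P3 * Pm / (D1 * D2 * D3 * D4) * ((1 - A) * (1 - B) / (E * B * q))"
  have pw: "q ^ (4 * m) = (q ^ m) ^ 4" "(q ^ 4) ^ m = (q ^ m) ^ 4" "q ^ (2 * m) = (q ^ m) ^ 2"
    "(q ^ 2) ^ m = (q ^ m) ^ 2" "q ^ (3 * m) = (q ^ m) ^ 3"
    by (simp_all add: mult.commute flip: power_mult)
  have q4: "qpoch (q ^ 4) (q ^ 4) m * (1 - x ^ 4) = D1"
    by (simp add: D1_def qpoch_Suc x_def power_mult_distrib pw)
  have qB: "qpoch (A * q ^ 4 / B) (q ^ 4) m * (1 - A * x ^ 4 / B) = D2"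
    by (simp add: D2_def qpoch_Suc x_def power_mult_distrib pw)
  have qc: "qpoch (q ^ 3 * c) q m * (1 - c * (q ^ 2 * x)) = D3"
    by (simp add: D3_def qpoch_Suc x_def eval_nat_numeral mult_ac)
  have qAB: "qpoch (q ^ 2 * A * B) q (2 * m) * (1 - A * B * x ^ 2) * (1 - q * A * B * x ^ 2) = D4"
    by (simp add: D4_def qpoch_Suc x_def pw power_mult_distrib) (simp add: eval_nat_numeral mult_ac)
  \<comment> \<open>The products starting at \<open>A * B\<close> and at
    \<open>q ^ 2 * A * B\<close> differ by two factors at either end; both sides are the product of
    \<open>2 * m + 4\<close> factors from \<open>A * B\<close> on.\<close>
  have qAB': "qpoch (A * B) q (2 * Suc m) * (1 - A * B * x ^ 2) * (1 - q * A * B * x ^ 2) = (1 - A * B) * (1 - q * A * B) * D4"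
  proof -
    have "qpoch (A * B) q (2 * Suc m) * (1 - A * B * x ^ 2) * (1 - q * A * B * x ^ 2) = qpoch (A * B) q (Suc (Suc (2 * Suc m)))"
      by (simp add: qpoch_Suc x_def pw power_mult_distrib) (simp add: eval_nat_numeral mult_ac)
    also have "\<dots> = (1 - A * B) * (1 - q * A * B) * D4"
      unfolding D4_def qpoch_Suc_shift[of _ _ "Suc _"] qpoch_Suc_shift[of "_ * q" _ "2 * Suc m"]
      by (simp add: power2_eq_square mult_ac)
    finally show ?thesis .
  qed
  \<comment> \<open>The same with three factors at either end. Here \<open>c\<close> is the
    parameter \<open>q ^ 3 / (a * b ^ 2)\<close> at \<open>a = q * A\<close>,
    \<open>b = q * B\<close>.\<close>
  have qc': "qpoch c q (Suc m) * ((1 - c * x) * (1 - c * q * x) * (1 - c * q^2 * x)) = (1 - c) * (1 - c * q) * (1 - c * q^2) * D3"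
  proof -
    have "qpoch c q (Suc m) * ((1 - c * x) * (1 - c * q * x) * (1 - c * q^2 * x)) = qpoch c q (Suc (Suc (Suc (Suc m))))"
      by (simp add: qpoch_Suc x_def) (simp add: eval_nat_numeral mult_ac)
    also have "\<dots> = (1 - c) * (1 - c * q) * (1 - c * q^2) * D3"
      unfolding D3_def qpoch_Suc_shift[of _ _ "Suc (Suc (Suc m))"] qpoch_Suc_shift[of _ _ "Suc (Suc m)"] qpoch_Suc_shift[of _ _ "Suc m"]
      by (simp add: eval_nat_numeral mult_ac)
    finally show ?thesis .
  qed
  have gx: "1 - x ^ 4 \<noteq> 0" "1 - A * x ^ 4 / B \<noteq> 0" "1 - A * B * x ^ 2 \<noteq> 0" "1 - q * A * B * x ^ 2 \<noteq> 0"
  proof -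
    have "x ^ 4 = q ^ (4 * Suc m)" "x ^ 2 = q ^ (2 * Suc m)" by (simp_all only: x_def mult.commute flip: power_mult)
    moreover have "A * B * q ^ (Suc (2 * Suc m)) \<noteq> 1" "A * B * q ^ (2 * Suc m) \<noteq> 1" "A * q ^ (4 * Suc m) \<noteq> B" "q ^ (4 * Suc m) \<noteq> 1"
      using genD by (metis zero_less_Suc mult_pos_pos zero_less_numeral)+
    ultimately show "1 - x ^ 4 \<noteq> 0" "1 - A * x ^ 4 / B \<noteq> 0" "1 - A * B * x ^ 2 \<noteq> 0" "1 - q * A * B * x ^ 2 \<noteq> 0"
      using nz by (simp_all add: mult_ac del: mult_Suc_right)
  qed
  have cx: "1 - c * (q ^ 2 * x) \<noteq> 0" "1 - c * x \<noteq> 0" "1 - c * q * x \<noteq> 0" "1 - c * q ^ 2 * x \<noteq> 0"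
      "1 - c \<noteq> 0" "1 - c * q \<noteq> 0" "1 - c * q ^ 2 \<noteq> 0"
    using c_ne[of "Suc m"] c_ne[of "Suc (Suc m)"] c_ne[of "Suc (Suc (Suc m))"] c_ne[of 0] c_ne[of 1] c_ne[of 2]
    by (simp_all add: x_def power2_eq_square mult_ac)
  have i1: "inverse (qpoch (q ^ 4) (q ^ 4) m) = (1 - x ^ 4) * inverse D1"
    using inverse_eq_of_mult_eq[of _ _ 1, simplified, OF q4 gx(1)] by simp
  have i2: "inverse (qpoch (A * q ^ 4 / B) (q ^ 4) m) = (1 - A * x ^ 4 / B) * inverse D2"
    using inverse_eq_of_mult_eq[of _ _ 1, simplified, OF qB gx(2)] by simp
  have i3: "inverse (qpoch (q ^ 3 * c) q m) = (1 - c * (q ^ 2 * x)) * inverse D3"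
    using inverse_eq_of_mult_eq[of _ _ 1, simplified, OF qc cx(1)] by simp
  have i4: "inverse (qpoch (q ^ 2 * A * B) q (2 * m)) = (1 - A * B * x ^ 2) * (1 - q * A * B * x ^ 2) * inverse D4"
    using gx by (subst inverse_eq_of_mult_eq[of _ "(1 - A * B * x ^ 2) * (1 - q * A * B * x ^ 2)" 1 D4]) (simp_all only: qAB mult.assoc[symmetric] mult_eq_0_iff, simp_all)
  have i5: "inverse (qpoch (A * B) q (2 * Suc m)) =
      (1 - A * B * x ^ 2) * (1 - q * A * B * x ^ 2) * inverse ((1 - A * B) * (1 - q * A * B)) * inverse D4"
    using gx nz by (intro inverse_eq_of_mult_eq) (simp_all only: qAB' mult_eq_0_iff mult.assoc[symmetric], simp_all)
  have i6: "inverse (qpoch c q (Suc m)) = (1 - c * x) * (1 - c * q * x) * (1 - c * q^2 * x) * inverse ((1 - c) * (1 - c * q) * (1 - c * q^2)) * inverse D3"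
    using cx by (intro inverse_eq_of_mult_eq) (simp_all only: qc' mult_eq_0_iff, simp_all)
  have c_factor: "A * B ^ 2 * (1 - c * y) = A * B^2 - y" for y
    using nz by (simp add: c_def field_simps)
  have B_factor: "1 - y / B = (B - y) * inverse B" for y
    using nz by (simp add: field_simps)
  have q_factor: "1 + y / q = (q + y) * inverse q" for y
    using nz by (simp add: field_simps)
  have c1: "quartic_cert A B q m = - (Z * ((q^2-A^2*B^3*x)*(1-x^4)*(B-A*x^4)*(A*B^2-q^2*x)*(1-A*B*x^2)*(1-q*A*B*x^2)))"
  proof -
    have g: "q - A ^ 2 * B ^ 3 * q ^ m = (q^2-A^2*B^3*x) * inverse q"
      using nz by (simp add: x_def field_simps power2_eq_square)
    have "quartic_cert A B q m = - (A * B ^ 2) * (1 - A) * (1 - B) * Pa * Pb * P3 * Pm * ((q^2-A^2*B^3*x) * inverse q)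
        * inverse E * inverse (qpoch (q ^ 4) (q ^ 4) m) * inverse (qpoch (A * q ^ 4 / B) (q ^ 4) m) * inverse (qpoch (q ^ 3 * c) q m) * inverse (qpoch (q ^ 2 * A * B) q (2 * m))"
      unfolding quartic_cert_def E_def Pa_def Pb_def P3_def Pm_def c_def g[symmetric] by (simp add: divide_inverse mult.assoc)
    also have "\<dots> = - ((1 - A) * (1 - B) * Pa * Pb * P3 * Pm * ((q^2-A^2*B^3*x) * inverse q)
        * inverse E * ((1 - x ^ 4) * inverse D1) * ((B - A * x ^ 4) * inverse B * inverse D2) * (A * B ^ 2 * (1 - c * (q ^ 2 * x))) * inverse D3 * ((1 - A * B * x ^ 2) * (1 - q * A * B * x ^ 2) * inverse D4))"
      unfolding i1 i2 i3 i4 B_factor by (simp only: mult_minus_left mult_minus_right mult_ac)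
    also have "\<dots> = - (Z * ((q^2-A^2*B^3*x)*(1-x^4)*(B-A*x^4)*(A*B^2-q^2*x)*(1-A*B*x^2)*(1-q*A*B*x^2)))"
      unfolding c_factor Z_def divide_inverse inverse_mult_distrib by (simp only: mult_ac)
    finally show ?thesis .
  qed
  have c2: "quartic_cert A B q (Suc m) = - (Z * (A*(B-q*x^3)*(B-q^2*x^3)*(B-x^3)*(q-A^2*B^3*x)*(1-A*x)*(1-B*x)*(q+A*B*x^2)))"
  proof -
    have a: "qpoch (q * A) q (Suc m) = Pa * (1 - A * x)" "qpoch (q * B) q (Suc m) = Pb * (1 - B * x)"
      by (simp_all add: qpoch_Suc Pa_def Pb_def x_def mult_ac)
    have d: "qpoch (- (q * A * B)) (q ^ 2) (Suc m) = Pm * ((q + A * B * x ^ 2) * inverse q)"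
      using nz by (simp add: qpoch_Suc Pm_def x_def pw flip: q_factor) (simp add: power2_eq_square mult_ac)
    have "qpoch (q / B) q (3 * Suc m + 2) = P3 * (1 - x ^ 3 / B) * (1 - q * x ^ 3 / B) * (1 - q ^ 2 * x ^ 3 / B)"
    proof -
      have "3 * Suc m + 2 = Suc (Suc (Suc (3 * m + 2)))" by simp
      thus ?thesis
        by (simp only: qpoch_Suc P3_def x_def pw power_mult_distrib power_add power_Suc)
          (simp add: eval_nat_numeral mult_ac)
    qed
    hence b: "qpoch (q / B) q (3 * Suc m + 2) = P3 * ((B - x ^ 3) * inverse B) * ((B - q * x ^ 3) * inverse B) * ((B - q ^ 2 * x ^ 3) * inverse B)"
      by (simp only: B_factor)
    have g: "q - A ^ 2 * B ^ 3 * q ^ Suc m = q - A^2 * B^3 * x" by (simp add: x_def)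
    have "quartic_cert A B q (Suc m) = - (A * B ^ 2) * (1 - A) * (1 - B) * (Pa * (1 - A * x)) * (Pb * (1 - B * x))
        * (P3 * ((B - x ^ 3) * inverse B) * ((B - q * x ^ 3) * inverse B) * ((B - q ^ 2 * x ^ 3) * inverse B))
        * (Pm * ((q + A * B * x ^ 2) * inverse q)) * (q - A^2 * B^3 * x) * inverse E * inverse D1 * inverse D2 * inverse D3 * inverse D4"
      unfolding quartic_cert_def E_def a b d g D1_def D2_def D3_def D4_def c_def by (simp add: divide_inverse mult.assoc)
    also have "\<dots> = - (A * (1 - A) * (1 - B) * (Pa * (1 - A * x)) * (Pb * (1 - B * x))
        * (P3 * ((B - x ^ 3) * (B - q * x ^ 3) * (B - q ^ 2 * x ^ 3) * inverse B))
        * (Pm * ((q + A * B * x ^ 2) * inverse q)) * (q - A^2 * B^3 * x) * inverse E * inverse D1 * inverse D2 * inverse D3 * inverse D4) * (B * inverse B) ^ 2"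
      by (simp only: mult_minus_left mult_minus_right power2_eq_square mult_ac)
    also have "(B * inverse B) ^ 2 = 1" using nz by simp
    finally show ?thesis
      unfolding Z_def divide_inverse inverse_mult_distrib by (simp only: mult_1_left mult_1_right mult_minus_left mult_minus_right mult_ac)
  qed
  have c3: "quartic_ratio A B q * quartic_term (q * A) (q * B) q (Suc m)
      = Z * (x*(1-q*A*x^5)*(A*B^2-x)*(A*B^2-q*x)*(A*B^2-q^2*x)*(1-A*x)*(1-B*x)*(q+A*B*x^2))"
  proof -
    have a: "qpoch (q * A) q (Suc m) = Pa * (1 - A * x)" "qpoch (q * B) q (Suc m) = Pb * (1 - B * x)"
      by (simp_all add: qpoch_Suc Pa_def Pb_def x_def mult_ac)
    have d: "qpoch (- (q * A * (q * B) / q)) (q ^ 2) (Suc m) = Pm * ((q + A * B * x ^ 2) * inverse q)"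
      using nz by (simp add: qpoch_Suc Pm_def x_def pw flip: q_factor) (simp add: power2_eq_square mult_ac)
    \<comment> \<open>This product starts at \<open>1 / B\<close>. Splitting that factor off leaves
      \<open>3 * m + 2\<close> factors from \<open>q / B\<close> on, which explains the length of
      \<open>P3\<close> and the factor \<open>1 - B\<close> in the certificate.\<close>
    have b: "qpoch (q / (q * B)) q (3 * Suc m) = - ((1 - B) * inverse B * P3)"
    proof -
      have "3 * Suc m = Suc (3 * m + 2)" by simp
      moreover have "1 - 1 / B = - ((1 - B) * inverse B)" using nz by (simp add: field_simps)
      ultimately show ?thesis using nz by (simp only: qpoch_Suc_shift) (simp add: P3_def)
    qed
    have g: "1 - q * A * q ^ (5 * Suc m) = 1 - q * A * x ^ 5"
      by (simp only: x_def mult.commute flip: power_mult)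
    have e: "q * A * q ^ 4 / (q * B) = A * q ^ 4 / B" "q ^ 3 / (q * A * (q * B) ^ 2) = c" "q * A * (q * B) = q ^ 2 * A * B"
      using nz by (simp_all add: c_def field_simps eval_nat_numeral)
    have "quartic_term (q * A) (q * B) q (Suc m) = (1 - q * A * x ^ 5) * (Pa * (1 - A * x)) * (Pb * (1 - B * x)) * - ((1 - B) * inverse B * P3)
        * (Pm * ((q + A * B * x ^ 2) * inverse q)) * x * inverse D1 * inverse D2 * inverse (qpoch c q (Suc m)) * inverse D4"
      unfolding quartic_term_def a b d g unfolding e D1_def D2_def D4_def x_def by (simp only: divide_inverse inverse_mult_distrib mult.assoc)
    also have "\<dots> = (1 - q * A * x ^ 5) * (Pa * (1 - A * x)) * (Pb * (1 - B * x)) * - ((1 - B) * inverse B * P3)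
        * (Pm * ((q + A * B * x ^ 2) * inverse q)) * x * inverse D1 * inverse D2 *
         ((1 - c * x) * (1 - c * q * x) * (1 - c * q^2 * x) * inverse ((1 - c) * (1 - c * q) * (1 - c * q^2)) * inverse D3) * inverse D4"
      unfolding i6 ..
    finally have t: "quartic_term (q * A) (q * B) q (Suc m) = \<dots>" .
    \<comment> \<open>In terms of \<open>c\<close>, the numerator of the ratio cancels the
      reciprocal brought in by \<open>i6\<close>; the three sign changes leave a minus, which meets
      the one from \<open>b\<close>.\<close>
    have r: "quartic_ratio A B q = - ((1 - A) * inverse E * (A * B ^ 2) ^ 3 * ((1 - c) * (1 - c * q) * (1 - c * q^2)))"
    proof -
      have "quartic_ratio A B q = - ((1 - A) * inverse E * ((A * B ^ 2 - 1) * (A * B ^ 2 - q) * (A * B ^ 2 - q ^ 2)))"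
        unfolding quartic_ratio_def E_def divide_inverse by algebra
      also have "(A * B ^ 2 - 1) * (A * B ^ 2 - q) * (A * B ^ 2 - q ^ 2) = (A * B ^ 2) ^ 3 * ((1 - c) * (1 - c * q) * (1 - c * q^2))"
        by (simp only: power3_eq_cube mult_1_left mult_1_right mult_ac flip: c_factor)
      finally show ?thesis by (simp only: mult.assoc)
    qed
    have "quartic_ratio A B q * quartic_term (q * A) (q * B) q (Suc m) =
        (((1 - A) * inverse E * (A * B ^ 2 * (1 - c * x)) * (A * B ^ 2 * (1 - c * (q * x))) * (A * B ^ 2 * (1 - c * (q ^ 2 * x))))
        * (1 - q * A * x ^ 5) * (Pa * (1 - A * x)) * (Pb * (1 - B * x)) * ((1 - B) * inverse B * P3)
        * (Pm * ((q + A * B * x ^ 2) * inverse q)) * x * inverse D1 * inverse D2 * inverse D3 * inverse D4) *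
        (((1 - c) * (1 - c * q) * (1 - c * q^2)) * inverse ((1 - c) * (1 - c * q) * (1 - c * q^2)))"
      unfolding r t by (simp only: mult_minus_left mult_minus_right minus_minus power3_eq_cube mult_ac)
    also have "((1 - c) * (1 - c * q) * (1 - c * q^2)) * inverse ((1 - c) * (1 - c * q) * (1 - c * q^2)) = 1"
      using cx by (intro right_inverse) simp
    finally show ?thesis unfolding c_factor Z_def divide_inverse inverse_mult_distrib by (simp only: mult_1_left mult_1_right mult_ac)
  qed
  have c4: "quartic_term A B q (Suc m) = Z * (x*(1-A*x^5)*(q^2-A^2*B^2)*(q^2-A*B^3)*(1-A*B*x^2)*(1-q*A*B*x^2)*(B-x^3))"
  proof -
    have a: "qpoch A q (Suc m) = (1 - A) * Pa" "qpoch B q (Suc m) = (1 - B) * Pb"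
      by (simp_all add: qpoch_Suc_shift Pa_def Pb_def mult_ac)
    have d: "qpoch (- (A * B / q)) (q ^ 2) (Suc m) = (q + A * B) * inverse q * Pm"
      using nz by (simp add: qpoch_Suc_shift Pm_def flip: q_factor) (simp add: power2_eq_square mult_ac)
    have b: "qpoch (q / B) q (3 * Suc m) = P3 * ((B - x ^ 3) * inverse B)"
    proof -
      have "3 * Suc m = Suc (3 * m + 2)" by simp
      thus ?thesis
        by (simp only: qpoch_Suc P3_def x_def pw power_mult_distrib power_add power_Suc flip: B_factor)
          (simp add: eval_nat_numeral mult_ac)
    qed
    have g: "1 - A * q ^ (5 * Suc m) = 1 - A * x ^ 5"
      by (simp only: x_def mult.commute flip: power_mult)
    have e: "q ^ 3 / (A * B ^ 2) = q ^ 3 * c" by (simp add: c_def)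
    have "quartic_term A B q (Suc m) = (1 - A * x ^ 5) * ((1 - A) * Pa) * ((1 - B) * Pb) * (P3 * ((B - x ^ 3) * inverse B))
        * ((q + A * B) * inverse q * Pm) * x * inverse D1 * inverse D2 * inverse D3
        * ((1 - A * B * x ^ 2) * (1 - q * A * B * x ^ 2) * inverse ((1 - A * B) * (1 - q * A * B)) * inverse D4)"
      unfolding quartic_term_def a b d g i5[symmetric] unfolding e D1_def D2_def D3_def x_def by (simp only: divide_inverse inverse_mult_distrib mult.assoc)
    \<comment> \<open>Puts the term over \<open>E\<close>, the denominator shared by the ratio and
      the certificate.\<close>
    also have "inverse ((1 - A * B) * (1 - q * A * B)) = (q - A * B) * (q ^ 2 - A * B ^ 3) * inverse E"
      using nz by (intro inverse_eq_of_mult_eq[of _ _ 1, simplified]) (simp_all add: E_def mult.assoc)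
    also have "(1 - A * x ^ 5) * ((1 - A) * Pa) * ((1 - B) * Pb) * (P3 * ((B - x ^ 3) * inverse B))
        * ((q + A * B) * inverse q * Pm) * x * inverse D1 * inverse D2 * inverse D3
        * ((1 - A * B * x ^ 2) * (1 - q * A * B * x ^ 2) * ((q - A * B) * (q ^ 2 - A * B ^ 3) * inverse E) * inverse D4)
       = Z * (x*(1-A*x^5)*((q+A*B)*(q-A*B))*(q^2-A*B^3)*(1-A*B*x^2)*(1-q*A*B*x^2)*(B-x^3))"
      unfolding Z_def divide_inverse inverse_mult_distrib by (simp only: mult_ac)
    also have "(q+A*B)*(q-A*B) = q^2-A^2*B^2" by algebra
    finally show ?thesis .
  qed
  have comb: "l1 - l2 = g0 - g1 \<Longrightarrow> - (z * g0) + (z * l1 - z * l2) = - (z * g1)" for z l1 l2 g0 g1 :: 'a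
    by algebra
  show ?thesis
    unfolding c1 c2 c3 c4 by (rule comb, rule certificate_identity)
qed

lemma sum_quartic_term:
  assumes "quartic_generic A B q"
  shows "(\<Sum>k\<le>m. quartic_ratio A B q * quartic_term (q * A) (q * B) q k - quartic_term A B q k) = quartic_cert A B q m"
proof (induction m)
  case 0
  show ?case using quartic_cert_0[OF assms] by simp
next
  case (Suc m)
  thus ?case using quartic_cert_Suc[OF assms, of m] by simp
qed

subsection \<open>Terminating quartic sums\<close>

lemma tendsto_qpoch [tendsto_intros]:
  fixes f g :: "'b \<Rightarrow> 'a :: {comm_ring_1, real_normed_algebra}"
  assumes "(f \<longlongrightarrow> a) F" "(g \<longlongrightarrow> p) F"
  shows "((\<lambda>x. qpoch (f x) (g x) k) \<longlongrightarrow> qpoch a p k) F"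
proof (induction k)
  case (Suc k)
  have "((\<lambda>x. g x ^ j) \<longlongrightarrow> p ^ j) F" for j
    by (induction j) (auto intro!: tendsto_intros assms)
  then show ?case unfolding qpoch_Suc by (intro tendsto_intros assms Suc)
qed simp

lemma norm_gt_1_nonzero: "norm (q::complex) > 1 \<Longrightarrow> q \<noteq> 0"
  by auto

lemma power_inj_norm:
  fixes q :: complex
  assumes "norm q > 1" "q ^ i = q ^ j"
  shows "i = j"
proof -
  have "norm q ^ i = norm q ^ j" using assms(2) by (simp flip: norm_power)
  thus ?thesis using assms(1) power_inject_exp by blast
qed

text \<open>Clearing the powers of \<open>q\<close> from \<open>B\<close> turns each inequality that
  involves \<open>A\<close> into the hypothesis that \<open>A\<close> is no quotient of powers of
  \<open>q\<close>.\<close>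

lemma quartic_generic_negative_power:
  fixes q :: complex
  assumes q: "norm q > 1" and A: "\<And>i j. A * q ^ i \<noteq> q ^ j" and "A \<noteq> 0"
  shows "quartic_generic A (1 / q ^ Suc M) q"
proof -
  have q0: "q \<noteq> 0" by (rule norm_gt_1_nonzero[OF q])
  have "q ^ j \<noteq> 1" if "j > 0" for j using power_inj_norm[OF q, of j 0] that by auto
  moreover have "A * q ^ j \<noteq> 1 / q ^ Suc M" for j
    using A[of "j + Suc M" 0] q0 by (auto simp: field_simps power_add)
  moreover have "A * (1 / q ^ Suc M) ^ 2 \<noteq> q ^ j" for j
    using A[of 0 "j + Suc M * 2"] q0 by (simp add: field_simps power_add power_mult power2_eq_square)
  moreover have "A * (1 / q ^ Suc M) * q ^ j \<noteq> 1" for j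
    using A[of j "Suc M"] q0 by (auto simp: field_simps)
  moreover have "A * (1 / q ^ Suc M) \<noteq> q"
    using A[of 0 "Suc (Suc M)"] q0 by (auto simp: field_simps)
  moreover have "A * (1 / q ^ Suc M) ^ 3 \<noteq> q ^ 2"
    using A[of 0 "2 + Suc M * 3"] q0 by (simp add: field_simps power_add power_mult power2_eq_square power3_eq_cube) (simp add: eval_nat_numeral mult_ac)
  ultimately show ?thesis using q0 \<open>A \<noteq> 0\<close> unfolding quartic_generic_def by auto
qed

text \<open>For \<open>q\<close> nonzero, the choice \<open>b = 1 / q ^ M\<close> makes all terms
  with \<open>k > M\<close> vanish, so this is the whole series.\<close>

definition quartic_sum :: "'a::field \<Rightarrow> 'a \<Rightarrow> nat \<Rightarrow> 'a" where
  "quartic_sum a q M = (\<Sum>k\<le>M. quartic_term a (1 / q ^ M) q k)"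

lemma qpoch_negative_power:
  assumes "q \<noteq> (0::'a::field)"
  shows "qpoch (1 / q ^ M) q (Suc M) = 0"
  using assms by (auto simp: qpoch_eq_0_iff)

text \<open>Since \<open>q * B = 1 / q ^ M\<close>, both the certificate at \<open>M + 1\<close> and
  the last shifted term contain \<open>qpoch (1 / q ^ M) q (Suc M) = 0\<close>: the telescoped sum
  is 0, and the shifted sum ends at \<open>M\<close>.\<close>

lemma quartic_sum_Suc:
  fixes q :: complex
  assumes q: "norm q > 1" and A: "\<And>i j. A * q ^ i \<noteq> q ^ j" and A0: "A \<noteq> 0"
  shows "quartic_sum A q (Suc M) = quartic_ratio A (1 / q ^ Suc M) q * quartic_sum (q * A) q M"
proof -
  let ?B = "1 / q ^ Suc M"
  have q0: "q \<noteq> 0" by (rule norm_gt_1_nonzero[OF q])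
  hence qB: "q * ?B = 1 / q ^ M" by simp
  have last: "quartic_term (q * A) (1 / q ^ M) q (Suc M) = 0"
    by (simp only: quartic_term_def qpoch_negative_power[OF q0]) simp
  have "quartic_cert A ?B q (Suc M) = 0"
    unfolding quartic_cert_def qB qpoch_negative_power[OF q0] by simp
  hence "(\<Sum>k\<le>Suc M. quartic_ratio A ?B q * quartic_term (q * A) (1 / q ^ M) q k - quartic_term A ?B q k) = 0"
    using sum_quartic_term[OF quartic_generic_negative_power[OF q A A0], of M "Suc M"] unfolding qB by simp
  hence "quartic_sum A q (Suc M) = (\<Sum>k\<le>Suc M. quartic_ratio A ?B q * quartic_term (q * A) (1 / q ^ M) q k)"
    unfolding quartic_sum_def sum_subtractf by simp
  also have "\<dots> = quartic_ratio A ?B q * quartic_sum (q * A) q M"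
    unfolding quartic_sum_def sum_distrib_left by (simp add: last)
  finally show ?thesis .
qed

text \<open>The absolute value of the left side lies strictly between the consecutive powers of
  \<open>norm q\<close> with exponents \<open>e + i\<close> and \<open>e + i + 1\<close>. Perturbing
  \<open>q ^ e\<close> by \<open>s\<close> thus secures the genericity that the recurrence
  requires.\<close>

lemma between_powers:
  fixes q :: complex
  assumes "1 < s" "s < norm q"
  shows "q ^ e * of_real s * q ^ i \<noteq> q ^ j"
proof
  assume "q ^ e * of_real s * q ^ i = q ^ j"
  hence "norm (q ^ e * of_real s * q ^ i) = norm (q ^ j)" by (simp only:)
  hence "norm q ^ e * s * norm q ^ i = norm q ^ j"
    using assms(1) by (simp add: norm_mult norm_power)
  hence eq: "s * norm q ^ (e + i) = norm q ^ j" by (simp add: power_add mult_ac)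
  have n: "norm q > 1" using assms by simp
  have X: "norm q ^ (e + i) > 0" using n by (intro zero_less_power) linarith
  have "1 * norm q ^ (e + i) < s * norm q ^ (e + i)" "s * norm q ^ (e + i) < norm q * norm q ^ (e + i)"
    using X assms by (simp_all only: mult_less_cancel_right_pos)
  hence "norm q ^ (e + i) < norm q ^ j" "norm q ^ j < norm q ^ Suc (e + i)"
    unfolding eq by simp_all
  hence "e + i < j" "j < Suc (e + i)" using n by (simp_all only: power_strict_increasing_iff)
  thus False by simp
qed

text \<open>
  The individual terms of the intermediate sums may have poles at \<open>s = 1\<close>, hence the limit.
\<close>
lemma quartic_sum_tendsto:
  fixes q :: complex
  assumes q: "norm q > 1" and N: "\<not> 4 dvd N" and s: "s \<longlonglongrightarrow> 1" "\<And>i. 1 < s i" "\<And>i. s i < norm q"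
    and "M \<le> N"
  shows "\<exists>L. (\<lambda>i. quartic_sum (q ^ (3 * N + 2 - M) * of_real (s i)) q M) \<longlonglongrightarrow> L \<and> (M = N \<longrightarrow> L = 0)"
  using \<open>M \<le> N\<close>
proof (induction M)
  case 0
  have eq: "quartic_sum a q 0 = 1 - a" for a
    by (simp add: quartic_sum_def quartic_term_def)
  have "(\<lambda>i. quartic_sum (q ^ (3 * N + 2 - 0) * of_real (s i)) q 0) \<longlonglongrightarrow> 1 - q ^ (3 * N + 2) * of_real 1"
    unfolding eq diff_zero by (intro tendsto_intros s)
  \<comment> \<open>The claim about \<open>M = N\<close> is therefore vacuous at
    \<open>M = 0\<close>.\<close>
  moreover have "N \<noteq> 0" using N by (metis dvd_0_right)
  ultimately show ?case by metis
next
  case (Suc M)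
  then obtain L where L: "(\<lambda>i. quartic_sum (q ^ (3 * N + 2 - M) * of_real (s i)) q M) \<longlonglongrightarrow> L" by auto
  \<comment> \<open>The exponent drops by one whenever \<open>M\<close> grows by one, as the
    recurrence demands, and reaches \<open>2 * N + 2\<close> at \<open>M = N\<close>.\<close>
  define A where "A = q ^ (3 * N + 2 - Suc M)"
  define B where "B = 1 / q ^ Suc M"
  have q0: "q \<noteq> 0" by (rule norm_gt_1_nonzero[OF q])
  have qA: "q ^ (3 * N + 2 - M) = q * A"
    using Suc.prems by (simp add: A_def flip: power_Suc) (simp add: Suc_diff_le)
  have AB: "A * B = q ^ (3 * N - 2 * M)"
  proof -
    have "3 * N + 2 - Suc M = (3 * N - 2 * M) + Suc M" using Suc.prems by simp
    thus ?thesis using q0 unfolding A_def B_def by (simp only: power_add) simp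
  qed
  have AB2: "A * B ^ 2 = q ^ (3 * N - 3 * M - 1)"
  proof -
    have "3 * N - 2 * M = (3 * N - 3 * M - 1) + Suc M" using Suc.prems by simp
    hence "A * B * B = q ^ (3 * N - 3 * M - 1)"
      using q0 unfolding AB by (simp only: power_add B_def) simp
    thus ?thesis by (simp add: power2_eq_square mult.assoc)
  qed
  \<comment> \<open>Stated multiplicatively because the exponent of \<open>A * B ^ 3\<close>, namely
    \<open>3 N - 4 M - 2\<close>, can be negative.\<close>
  have AB3: "A * B ^ 3 * q ^ Suc M = A * B ^ 2"
    using q0 by (simp add: B_def power3_eq_cube power2_eq_square)
  have inj: "q ^ i = q ^ j \<longleftrightarrow> i = j" for i j using power_inj_norm[OF q] by blast
  have nz: "1 - A * B \<noteq> 0" "1 - q * A * B \<noteq> 0" "q - A * B \<noteq> 0" "q ^ 2 - A * B ^ 3 \<noteq> 0"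
  proof -
    show "1 - A * B \<noteq> 0" using inj[of 0 "3 * N - 2 * M"] Suc.prems unfolding AB by simp
    show "1 - q * A * B \<noteq> 0" using inj[of 0 "Suc (3 * N - 2 * M)"] AB by (simp add: mult.assoc)
    show "q - A * B \<noteq> 0" using inj[of 1 "3 * N - 2 * M"] Suc.prems unfolding AB by simp
    show "q ^ 2 - A * B ^ 3 \<noteq> 0"
    proof
      assume "q ^ 2 - A * B ^ 3 = 0"
      hence "q ^ (2 + Suc M) = q ^ (3 * N - 3 * M - 1)" using AB3 AB2 by (simp only: power_add) auto
      hence "2 + Suc M = 3 * N - 3 * M - 1" by (simp only: inj)
      hence "3 * N = 4 * Suc M" by simp
      hence "4 dvd 3 * N" by simp
      hence "4 dvd N" by presburger
      thus False using N by simp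
    qed
  qed
  have lim: "(\<lambda>i. quartic_ratio (A * of_real (s i)) B q) \<longlonglongrightarrow> quartic_ratio (A * of_real 1) B q"
    unfolding quartic_ratio_def using nz by (intro tendsto_intros s) auto
  have eq: "quartic_sum (A * of_real (s i)) q (Suc M) = quartic_ratio (A * of_real (s i)) B q * quartic_sum (q ^ (3 * N + 2 - M) * of_real (s i)) q M" for i
    unfolding B_def qA mult.assoc
  proof (rule quartic_sum_Suc[OF q])
    show "A * of_real (s i) * q ^ i' \<noteq> q ^ j" for i' j unfolding A_def by (rule between_powers[OF s(2,3)])
    show "A * of_real (s i) \<noteq> 0" using q0 s(2)[of i] by (simp add: A_def)
  qed
  have "(\<lambda>i. quartic_sum (A * of_real (s i)) q (Suc M)) \<longlonglongrightarrow> quartic_ratio (A * of_real 1) B q * L"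
    unfolding eq by (intro tendsto_mult lim L)
  \<comment> \<open>In the last step \<open>A * B ^ 2 = q ^ 2\<close>, which kills the factor
    \<open>q ^ 2 - A * B ^ 2\<close> of the numerator.\<close>
  moreover have "quartic_ratio (A * of_real 1) B q = 0" if "Suc M = N"
    using that by (simp add: quartic_ratio_def AB2 flip: that)
  ultimately show ?case
    unfolding A_def by (intro exI[of _ "quartic_ratio (q ^ (3 * N + 2 - Suc M) * of_real 1) B q * L"]) auto
qed

text \<open>For the final parameters, all denominator products at \<open>s = 1\<close> start at a
  positive power of \<open>q\<close>, so no term has a pole and the limit is the actual
  value.\<close>

lemma quartic_term_tendsto:
  fixes q :: complex
  assumes q: "norm q > 1" and s: "s \<longlonglongrightarrow> 1"
  shows "(\<lambda>i. quartic_term (q ^ (2 * N + 2) * of_real (s i)) (1 / q ^ N) q k)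
     \<longlonglongrightarrow> quartic_term (q ^ (2 * N + 2) * of_real 1) (1 / q ^ N) q k"
proof -
  have q0: "q \<noteq> 0" by (rule norm_gt_1_nonzero[OF q])
  have pos: "q ^ j \<noteq> 1" if "j > 0" for j using power_inj_norm[OF q, of j 0] that by auto
  have nz: "qpoch (q ^ Suc i) (q ^ e) m \<noteq> 0" for i e m
    using pos[of "Suc i + e * j" for j] by (auto simp: qpoch_eq_0_iff simp flip: power_mult power_add power_Suc)
  let ?a = "q ^ (2 * N + 2) * of_real 1" and ?b = "1 / q ^ N"
  have 1: "?a * q ^ 4 / ?b = q ^ Suc (3 * N + 5)"
    by (simp add: field_simps eval_nat_numeral flip: power_add)
  have 2: "q ^ 3 / (?a * ?b ^ 2) = q ^ Suc 0"
    using q0 by (simp add: field_simps eval_nat_numeral power_add)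
  have 3: "?a * ?b = q ^ Suc (N + 1)"
    using q0 by (simp add: field_simps mult_2_right power_add)
  have den: "qpoch (q ^ 4) (q ^ 4) k * qpoch (?a * q ^ 4 / ?b) (q ^ 4) k * qpoch (q ^ 3 / (?a * ?b ^ 2)) q k * qpoch (?a * ?b) q (2 * k) \<noteq> 0"
    using nz[of 3 4 k] nz[of "3 * N + 5" 4 k] nz[of 0 1 k] nz[of "N + 1" 1 "2 * k"] unfolding 1 2 3 by simp
  have "?a * ?b ^ 2 \<noteq> 0" "?b \<noteq> 0" using q0 by simp_all
  with den q0 show ?thesis
    unfolding quartic_term_def by (intro tendsto_intros s)
qed

lemma quartic_sum_eq_0:
  fixes q :: complex
  assumes q: "norm q > 1" and N: "\<not> 4 dvd N"
  shows "quartic_sum (q ^ (2 * N + 2)) q N = 0"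
proof -
  \<comment> \<open>A sequence strictly between 1 and \<open>norm q\<close>; with
    \<open>i + 1\<close> in place of \<open>i + 2\<close> its first member would equal
    \<open>norm q\<close>.\<close>
  define s where "s = (\<lambda>i::nat. 1 + (norm q - 1) * inverse (real (i + 2)))"
  have "(\<lambda>i::nat. inverse (real (i + 2))) \<longlonglongrightarrow> 0"
    by (rule LIMSEQ_ignore_initial_segment[OF lim_inverse_n])
  hence "s \<longlonglongrightarrow> 1 + (norm q - 1) * 0" unfolding s_def by (intro tendsto_intros)
  hence s1: "s \<longlonglongrightarrow> 1" by simp
  have s2: "1 < s i" for i using q by (simp add: s_def)
  have s3: "s i < norm q" for i
  proof -
    have "(norm q - 1) * inverse (real (i + 2)) < (norm q - 1) * 1"
      using q by (intro mult_strict_left_mono) (auto simp: field_simps)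
    thus ?thesis by (simp add: s_def)
  qed
  have "(\<lambda>i. quartic_sum (q ^ (3 * N + 2 - N) * of_real (s i)) q N) \<longlonglongrightarrow> 0"
    using quartic_sum_tendsto[OF q N s1 s2 s3 order_refl] by blast
  moreover have "3 * N + 2 - N = 2 * N + 2" by simp
  ultimately have "(\<lambda>i. quartic_sum (q ^ (2 * N + 2) * of_real (s i)) q N) \<longlonglongrightarrow> 0" by simp
  moreover have "(\<lambda>i. quartic_sum (q ^ (2 * N + 2) * of_real (s i)) q N) \<longlonglongrightarrow> quartic_sum (q ^ (2 * N + 2) * of_real 1) q N"
    unfolding quartic_sum_def by (intro tendsto_sum quartic_term_tendsto q s1)
  ultimately show ?thesis using LIMSEQ_unique by fastforce
qed

subsection \<open>Values at roots of unity\<close>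

text \<open>
  The case distinction is needed since the cancellation of
  \<open>(w; p)\<^bsub>3k\<^esub>\<close> against \<open>(wp; p)\<^bsub>2k\<^esub>\<close> leaves the factor \<open>1 - w\<close> only for \<open>k > 0\<close>.
\<close>
definition regular_term :: "'a::field \<Rightarrow> 'a \<Rightarrow> nat \<Rightarrow> 'a" where
  "regular_term w p k = (if k = 0 then 1 - w ^ 2 else
    (1 - w ^ 2 * p ^ (5 * k)) * qpoch (w ^ 2) p k * qpoch (p / w) p k * (1 - w)
      * qpoch (- w) (p ^ 2) k * (\<Prod>j\<in>{2*k<..<3*k}. 1 - w * p ^ j) * p ^ k
    / (qpoch (p ^ 4) (p ^ 4) k * qpoch (w ^ 3 * p ^ 3) (p ^ 4) k * qpoch p p k))"

text \<open>The indices below \<open>3 * k\<close> split into 0, the range from 1 to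
  \<open>2 * k\<close>, and the rest. At \<open>k = 0\<close> there is no index 0 to split
  off.\<close>

lemma qpoch_triple:
  assumes "k > 0"
  shows "qpoch w p (3 * k) = (1 - w) * qpoch (w * p) p (2 * k) * (\<Prod>j\<in>{2*k<..<3*k}. 1 - w * p ^ j)"
proof -
  have set: "{..<3 * k} = {..<Suc (2 * k)} \<union> {2*k<..<3*k}" using assms by auto
  have "qpoch w p (3 * k) = qpoch w p (Suc (2 * k)) * (\<Prod>j\<in>{2*k<..<3*k}. 1 - w * p ^ j)"
    unfolding qpoch_def set by (rule prod.union_disjoint) auto
  thus ?thesis by (simp only: qpoch_Suc_shift)
qed

text \<open>Hypothesis \<open>wp\<close> permits cancelling \<open>qpoch (w * p) p (2 * k)\<close>;
  \<open>regular_term\<close> remains meaningful when that product vanishes, as can happen at roots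
  of unity.\<close>

lemma quartic_term_eq_regular_term:
  assumes w: "w \<noteq> (0::'a::field)" and p: "p \<noteq> 0" and wp: "\<And>j. w * p ^ Suc j \<noteq> 1"
  shows "quartic_term (w ^ 2) (p / w) p k = regular_term w p k"
proof (cases "k = 0")
  case True
  thus ?thesis by (simp add: quartic_term_def regular_term_def)
next
  case False
  have e: "p / (p / w) = w" "w ^ 2 * (p / w) = w * p" "- (w * p / p) = - w" "w ^ 2 * p ^ 4 / (p / w) = w ^ 3 * p ^ 3"
    "p ^ 3 / (w ^ 2 * (p / w) ^ 2) = p"
    using w p by (simp_all add: field_simps eval_nat_numeral)
  have "qpoch (w * p) p (2 * k) \<noteq> 0"
    using wp by (auto simp: qpoch_eq_0_iff mult.assoc)
  thus ?thesis using False
    unfolding quartic_term_def e regular_term_def by (simp add: qpoch_triple) (simp add: mult_ac)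
qed

lemma qpoch_double: "qpoch z z (2 * k) = qpoch z (z ^ 2) k * qpoch (z ^ 2) (z ^ 2) k"
  by (induction k) (simp_all add: qpoch_Suc mult_ac power2_eq_square flip: power_mult, simp add: power_mult power_mult_distrib power2_eq_square mult_ac)

lemma qpoch_square: "qpoch (x ^ 2) (p ^ 2) k = qpoch x p k * qpoch (- x) p k"
  by (induction k) (simp_all add: qpoch_Suc, simp add: algebra_simps power2_eq_square power_mult_distrib)

text \<open>Two products split: \<open>(z; z)_2k\<close> by parity of the exponents,
  \<open>(z^2; z^8)_k\<close> as a difference of squares. The factor \<open>X\<close> arises both
  from moving \<open>(z; z^2)_2k\<close> to start at \<open>z^3\<close> and from moving
  \<open>(z; z^4)_k\<close> to start at \<open>z^5\<close>, and cancels.\<close>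

lemma summand_eq_regular_term:
  fixes z :: "'a::field"
  assumes z: "\<And>j. j > 0 \<Longrightarrow> z ^ j \<noteq> 1" and z0: "z \<noteq> 0"
  shows "(1 - z ^ (10 * k + 2)) / (1 - z)
      * ((qpoch z z (2 * k) * qpoch z (z ^ 2) (3 * k) * qpoch (z ^ 2) (z ^ 8) k)
         / (qpoch2 (z ^ 9) (z ^ 8) (z ^ 8) k * qpoch z (z ^ 2) (2 * k)
            * qpoch (z ^ 5) (z ^ 4) k * qpoch (z ^ 2) (z ^ 2) k))
      * z ^ (2 * k) = regular_term z (z ^ 2) k / (1 - z)"
proof (cases "k = 0")
  case True
  thus ?thesis by (simp add: qpoch2_def regular_term_def power2_eq_square)
next
  case False
  have nz: "qpoch (z ^ Suc i) (z ^ e) m \<noteq> 0" for i e m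
    using z[of "Suc i + e * j" for j] by (auto simp: qpoch_eq_0_iff simp flip: power_mult power_add power_Suc)
  define X where "X = 1 - z ^ Suc (4 * k)"
  have X: "X \<noteq> 0" using z[of "Suc (4 * k)"] by (simp add: X_def)
  define Y where "Y = qpoch z (z ^ 4) k"
  define V where "V = qpoch z (z ^ 2) (2 * k)"
  have z1: "1 - z \<noteq> 0" using z[of 1] by simp
  have V0: "V \<noteq> 0" using nz[of 0 2 "2 * k"] by (simp add: V_def)
  have Y0: "Y \<noteq> 0" using nz[of 0 4 k] by (simp add: Y_def)
  have P2: "qpoch (z ^ 2) (z ^ 2) k \<noteq> 0" using nz[of 1 2 k] by (simp add: numeral_2_eq_2)
  have 1: "(1 - z) * qpoch (z * z ^ 2) (z ^ 2) (2 * k) = V * X"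
    unfolding V_def X_def qpoch_Suc_shift[symmetric] qpoch_Suc by (simp flip: power_mult)
  have "(1 - z) * qpoch (z * z ^ 4) (z ^ 4) k = Y * X"
    unfolding Y_def X_def qpoch_Suc_shift[symmetric] qpoch_Suc by (simp flip: power_mult)
  hence 2: "qpoch (z ^ 5) (z ^ 4) k = Y * X / (1 - z)"
    using z1 by (simp add: field_simps eval_nat_numeral)
  have 3: "qpoch z (z ^ 2) (3 * k) = V * X * (\<Prod>j\<in>{2*k<..<3*k}. 1 - z * (z ^ 2) ^ j)"
    using qpoch_triple[of k z "z ^ 2"] 1 False by simp
  have 4: "qpoch (z ^ 2) (z ^ 8) k = Y * qpoch (- z) (z ^ 4) k"
    using qpoch_square[of z "z ^ 4" k] by (simp add: Y_def flip: power_mult)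
  have 5: "z ^ 2 / z = z" "z ^ 3 * (z ^ 2) ^ 3 = z ^ 9" "(z ^ 2) ^ 4 = z ^ 8" "(z ^ 2) ^ 2 = z ^ 4"
    "z ^ 2 * (z ^ 2) ^ (5 * k) = z ^ (10 * k + 2)" "(z ^ 2) ^ k = z ^ (2 * k)"
    using z0 by (simp add: power2_eq_square) (simp_all flip: power_mult power_add)
  show ?thesis
    unfolding regular_term_def 5 qpoch_double 2 3 4 V_def[symmetric] qpoch2_def
    using False X Y0 V0 z1 P2 by (simp add: mult_ac)
qed


lemma regular_term_tendsto:
  fixes v :: "'b \<Rightarrow> complex"
  assumes "(v \<longlongrightarrow> w) F" "(r \<longlongrightarrow> p) F" "w \<noteq> 0"
    and "qpoch (p ^ 4) (p ^ 4) k * qpoch (w ^ 3 * p ^ 3) (p ^ 4) k * qpoch p p k \<noteq> 0"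
  shows "((\<lambda>x. regular_term (v x) (r x) k) \<longlongrightarrow> regular_term w p k) F"
proof (cases "k = 0")
  case True
  show ?thesis unfolding regular_term_def if_P[OF True] by (intro tendsto_intros assms)
next
  case False
  show ?thesis unfolding regular_term_def if_not_P[OF False] by (intro tendsto_intros assms)
qed

text \<open>The choice \<open>w = p ^ (N + 1)\<close> yields \<open>a = p ^ (2 * N + 2)\<close> and
  \<open>b = 1 / p ^ N\<close>.\<close>

lemma sum_regular_term_eq_0:
  fixes p :: complex
  assumes p: "norm p > 1" and N: "\<not> 4 dvd N"
  shows "(\<Sum>k\<le>N. regular_term (p ^ Suc N) p k) = 0"
proof -
  have p0: "p \<noteq> 0" by (rule norm_gt_1_nonzero[OF p])
  have "p ^ Suc N * p ^ Suc j \<noteq> 1" for j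
    using power_inj_norm[OF p, of "Suc N + Suc j" 0] by (auto simp: power_add mult_ac)
  hence "regular_term (p ^ Suc N) p k = quartic_term ((p ^ Suc N) ^ 2) (p / p ^ Suc N) p k" for k
    using p0 by (intro quartic_term_eq_regular_term[symmetric]) auto
  moreover have "(p ^ Suc N) ^ 2 = p ^ (2 * N + 2)"
    by (simp only: mult_Suc mult.commute[of _ 2] add.commute flip: power_mult) simp
  moreover have "p / p ^ Suc N = 1 / p ^ N" using p0 by simp
  ultimately show ?thesis
    using quartic_sum_eq_0[OF p N] unfolding quartic_sum_def by simp
qed

section \<open>Passage to a primitive root of unity\<close>

lemma root_of_unity_power_eq_1_iff:
  assumes "z \<in> primitive_roots_unity n" "n > 0"
  shows "z ^ m = 1 \<longleftrightarrow> n dvd m"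
proof -
  have z: "z ^ n = 1" "\<And>m. 0 < m \<Longrightarrow> m < n \<Longrightarrow> z ^ m \<noteq> 1"
    using assms(1) by (auto simp: primitive_roots_unity_def)
  have "z ^ m = z ^ (n * (m div n) + m mod n)" by simp
  also have "\<dots> = z ^ (m mod n)" unfolding power_add power_mult z(1) by simp
  finally show ?thesis using z(2)[of "m mod n"] assms(2) by (auto simp: dvd_eq_mod_eq_0)
qed

text \<open>Oddness of \<open>n\<close> settles the first and third products. For the second,
  \<open>8 j + 9 = n m\<close> forces \<open>n m\<close> to be 1 modulo 8, so \<open>m\<close> is 5
  or 7 modulo 8 and \<open>m >= 5\<close>, whereas \<open>8 j + 9 <= 4 n\<close>. This is where the
  residue class of \<open>n\<close> enters.\<close>

lemma regular_denominators:
  assumes z: "z \<in> primitive_roots_unity n" and n: "n mod 8 = 5 \<or> n mod 8 = 7" and k: "k \<le> (n - 1) div 2"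
  shows "qpoch ((z ^ 2) ^ 4) ((z ^ 2) ^ 4) k * qpoch (z ^ 3 * (z ^ 2) ^ 3) ((z ^ 2) ^ 4) k * qpoch (z ^ 2) (z ^ 2) k \<noteq> 0"
proof -
  have n0: "n > 0" and odd: "odd n" using n by presburger+
  note iff = root_of_unity_power_eq_1_iff[OF z n0]
  have cop: "coprime n (2 ^ e)" for e using odd by simp
  have "\<not> n dvd 8 * Suc j" if "j < k" for j
  proof
    assume "n dvd 8 * Suc j"
    hence "n dvd Suc j" using cop[of 3] coprime_dvd_mult_right_iff[of n 8 "Suc j"] by (simp del: mult_Suc_right)
    hence "n \<le> Suc j" by (rule dvd_imp_le) simp
    thus False using that k n0 by linarith
  qed
  moreover have "\<not> n dvd 2 * Suc j" if "j < k" for j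
  proof
    assume "n dvd 2 * Suc j"
    hence "n dvd Suc j" using cop[of 1] coprime_dvd_mult_right_iff[of n 2 "Suc j"] by (simp del: mult_Suc_right)
    hence "n \<le> Suc j" by (rule dvd_imp_le) simp
    thus False using that k n0 by linarith
  qed
  moreover have "\<not> n dvd 8 * j + 9" if "j < k" for j
  proof
    assume "n dvd 8 * j + 9"
    then obtain m where m: "8 * j + 9 = n * m" by (auto elim: dvdE)
    have "((n mod 8) * (m mod 8)) mod 8 = (8 * j + 9) mod 8" unfolding m by (rule mod_mult_eq)
    also have "\<dots> = 1" by presburger
    finally have "((n mod 8) * (m mod 8)) mod 8 = 1" .
    moreover have "m mod 8 \<in> {0,1,2,3,4,5,6,7}" by auto
    ultimately have "m mod 8 = 5 \<or> m mod 8 = 7" using n by auto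
    hence "m \<ge> 5" by presburger
    hence "n * 5 \<le> n * m" by simp
    moreover have "8 * j + 9 \<le> 4 * n" using that k n0 by linarith
    ultimately show False using m n0 by linarith
  qed
  ultimately show ?thesis
    unfolding mult_eq_0_iff de_Morgan_disj qpoch_eq_0_iff
    by (auto simp: iff simp flip: power_mult power_add)
      (simp_all add: iff algebra_simps flip: power_Suc power_add)
qed

lemma sum_regular_term_root_of_unity:
  assumes z: "z \<in> primitive_roots_unity n" and n: "n mod 8 = 5 \<or> n mod 8 = 7"
  shows "(\<Sum>k\<le>(n - 1) div 2. regular_term z (z ^ 2) k) = 0"
proof -
  define N where "N = (n - 1) div 2"
  have n0: "n > 0" using n by presburger
  have nN: "2 * Suc N = Suc n" unfolding N_def using n by presburger
  \<comment> \<open>\<open>N\<close> is 2 or 3 modulo 4.\<close>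
  have N: "\<not> 4 dvd N" unfolding N_def using n by presburger
  have zn: "z ^ n = 1" using z by (simp add: primitive_roots_unity_def)
  hence nz: "norm z = 1" "z \<noteq> 0" using n0 power_eq_1_iff[OF zn] by auto
  \<comment> \<open>Approaches \<open>z ^ 2\<close> radially from outside the unit circle, so that
    \<open>sum_regular_term_eq_0\<close> applies to every \<open>p i\<close>; its powers
    \<open>p i ^ Suc N\<close> tend to \<open>z ^ (n + 1) = z\<close>.\<close>
  define p where "p i = z ^ 2 * of_real (1 + inverse (real (Suc i)))" for i
  have p1: "norm (p i) > 1" for i
    by (simp add: p_def norm_mult norm_power nz del: of_real_add)
  have "(\<lambda>i. inverse (real (Suc i))) \<longlonglongrightarrow> 0" by (rule LIMSEQ_inverse_real_of_nat)
  hence "p \<longlonglongrightarrow> z ^ 2 * of_real (1 + 0)" unfolding p_def by (intro tendsto_intros)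
  hence p: "p \<longlonglongrightarrow> z ^ 2" by simp
  have "(\<lambda>i. p i ^ Suc N) \<longlonglongrightarrow> (z ^ 2) ^ Suc N" by (intro tendsto_intros p)
  moreover have "(z ^ 2) ^ Suc N = z"
    unfolding power_mult[symmetric] nN using zn by simp
  ultimately have w: "(\<lambda>i. p i ^ Suc N) \<longlonglongrightarrow> z" by simp
  have "(\<lambda>i. \<Sum>k\<le>N. regular_term (p i ^ Suc N) (p i) k) \<longlonglongrightarrow> (\<Sum>k\<le>N. regular_term z (z ^ 2) k)"
    by (intro tendsto_sum regular_term_tendsto w p nz regular_denominators[OF z n]) (simp add: N_def)
  thus ?thesis
    unfolding sum_regular_term_eq_0[OF p1 N] N_def[symmetric] by (simp add: LIMSEQ_const_iff)
qed

subsection \<open>Evaluation of rational functions\<close>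

definition int_poly_eval :: "complex \<Rightarrow> int poly \<Rightarrow> complex" where
  "int_poly_eval z p = poly (map_poly of_int p) z"

lemma int_poly_eval_simps [simp]:
  "int_poly_eval z (p + q) = int_poly_eval z p + int_poly_eval z q"
  "int_poly_eval z (p * q) = int_poly_eval z p * int_poly_eval z q"
  "int_poly_eval z 0 = 0" "int_poly_eval z 1 = 1" "int_poly_eval z [:0, 1:] = z"
  "int_poly_eval z (- p) = - int_poly_eval z p"
proof -
  show minus: "int_poly_eval z (- p) = - int_poly_eval z p"
  proof -
    have "map_poly of_int (- p) = (- map_poly of_int p :: complex poly)"
      by (rule poly_eqI) (simp add: coeff_map_poly)
    thus ?thesis by (simp add: int_poly_eval_def)
  qed
qed (simp_all add: int_poly_eval_def map_poly_of_int_add map_poly_of_int_mult map_poly_1 map_poly_pCons)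

text \<open>
  A relation because \<open>A\<close> need not be regular at \<open>z\<close>; \<open>n / d\<close> need not be in lowest terms.
\<close>
definition ratfun_eval :: "complex \<Rightarrow> int poly fract \<Rightarrow> complex \<Rightarrow> bool" where
  "ratfun_eval z A v \<longleftrightarrow> (\<exists>n d. A = to_fract n / to_fract d \<and> int_poly_eval z d \<noteq> 0
     \<and> v = int_poly_eval z n / int_poly_eval z d)"

lemma ratfun_evalE:
  assumes "ratfun_eval z A v"
  obtains n d where "A = to_fract n / to_fract d" "int_poly_eval z d \<noteq> 0" "d \<noteq> 0"
    "v = int_poly_eval z n / int_poly_eval z d"
  using assms unfolding ratfun_eval_def by (metis int_poly_eval_simps(3))

lemma ratfun_eval_1: "ratfun_eval z 1 1"
  unfolding ratfun_eval_def by (intro exI[of _ 1]) simp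

lemma ratfun_eval_q: "ratfun_eval z \<q> z"
  unfolding ratfun_eval_def q_indet_def by (intro exI[of _ "[:0, 1:]"] exI[of _ 1]) simp

lemma ratfun_eval_0: "ratfun_eval z 0 0"
  unfolding ratfun_eval_def by (intro exI[of _ 0] exI[of _ 1]) simp

lemma ratfun_eval_add:
  assumes "ratfun_eval z A a" "ratfun_eval z B b"
  shows "ratfun_eval z (A + B) (a + b)"
proof -
  obtain n d m e where 1: "A = to_fract n / to_fract d" "int_poly_eval z d \<noteq> 0" "d \<noteq> 0" "a = int_poly_eval z n / int_poly_eval z d"
    and 2: "B = to_fract m / to_fract e" "int_poly_eval z e \<noteq> 0" "e \<noteq> 0" "b = int_poly_eval z m / int_poly_eval z e"
    using assms by (metis ratfun_evalE)
  show ?thesis unfolding ratfun_eval_def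
    using 1(2,3) 2(2,3) by (intro exI[of _ "n * e + m * d"] exI[of _ "d * e"]) (simp add: 1(1,4) 2(1,4) add_frac_eq)
qed

lemma ratfun_eval_mult:
  assumes "ratfun_eval z A a" "ratfun_eval z B b"
  shows "ratfun_eval z (A * B) (a * b)"
proof -
  obtain n d m e where 1: "A = to_fract n / to_fract d" "int_poly_eval z d \<noteq> 0" "d \<noteq> 0" "a = int_poly_eval z n / int_poly_eval z d"
    and 2: "B = to_fract m / to_fract e" "int_poly_eval z e \<noteq> 0" "e \<noteq> 0" "b = int_poly_eval z m / int_poly_eval z e"
    using assms by (metis ratfun_evalE)
  show ?thesis unfolding ratfun_eval_def
    using 1(2,3) 2(2,3) by (intro exI[of _ "n * m"] exI[of _ "d * e"]) (simp add: 1(1,4) 2(1,4))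
qed

lemma ratfun_eval_uminus:
  assumes "ratfun_eval z A a"
  shows "ratfun_eval z (- A) (- a)"
proof -
  obtain n d where "A = to_fract n / to_fract d" "int_poly_eval z d \<noteq> 0" "a = int_poly_eval z n / int_poly_eval z d"
    using assms by (rule ratfun_evalE)
  thus ?thesis unfolding ratfun_eval_def by (intro exI[of _ "- n"] exI[of _ d]) simp
qed

lemma ratfun_eval_diff:
  assumes "ratfun_eval z A a" "ratfun_eval z B b"
  shows "ratfun_eval z (A - B) (a - b)"
  using ratfun_eval_add[OF assms(1) ratfun_eval_uminus[OF assms(2)]] by simp

lemma ratfun_eval_divide:
  assumes "ratfun_eval z A a" "ratfun_eval z B b" "b \<noteq> 0"
  shows "ratfun_eval z (A / B) (a / b)"
proof -
  obtain n d where "B = to_fract n / to_fract d" "int_poly_eval z d \<noteq> 0" "b = int_poly_eval z n / int_poly_eval z d"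
    using assms(2) by (rule ratfun_evalE)
  with \<open>b \<noteq> 0\<close> have "ratfun_eval z (inverse B) (inverse b)"
    unfolding ratfun_eval_def by (intro exI[of _ d] exI[of _ n]) simp
  thus ?thesis unfolding divide_inverse by (rule ratfun_eval_mult[OF assms(1)])
qed

lemma ratfun_eval_power: "ratfun_eval z A a \<Longrightarrow> ratfun_eval z (A ^ k) (a ^ k)"
  by (induction k) (auto intro: ratfun_eval_mult ratfun_eval_1)

lemma ratfun_eval_prod:
  assumes "\<And>x. x \<in> S \<Longrightarrow> ratfun_eval z (f x) (g x)"
  shows "ratfun_eval z (prod f S) (prod g S)"
  using assms by (induction S rule: infinite_finite_induct) (auto intro: ratfun_eval_mult ratfun_eval_1)

lemma ratfun_eval_sum:
  assumes "\<And>x. x \<in> S \<Longrightarrow> ratfun_eval z (f x) (g x)"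
  shows "ratfun_eval z (sum f S) (sum g S)"
  using assms by (induction S rule: infinite_finite_induct) (auto intro: ratfun_eval_add ratfun_eval_0)

lemma ratfun_eval_qpoch:
  "ratfun_eval z A a \<Longrightarrow> ratfun_eval z B b \<Longrightarrow> ratfun_eval z (qpoch A B k) (qpoch a b k)"
  unfolding qpoch_def
  by (intro ratfun_eval_prod ratfun_eval_diff ratfun_eval_1 ratfun_eval_mult ratfun_eval_power)

lemmas ratfun_eval_intros = ratfun_eval_1 ratfun_eval_q ratfun_eval_diff ratfun_eval_uminus ratfun_eval_mult
  ratfun_eval_divide ratfun_eval_power ratfun_eval_prod ratfun_eval_qpoch

lemma ratfun_eval_regular_term:
  assumes "ratfun_eval z W w" "ratfun_eval z P p" "w \<noteq> 0"
    and "qpoch (p ^ 4) (p ^ 4) k * qpoch (w ^ 3 * p ^ 3) (p ^ 4) k * qpoch p p k \<noteq> 0"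
  shows "ratfun_eval z (regular_term W P k) (regular_term w p k)"
proof (cases "k = 0")
  case True
  show ?thesis unfolding regular_term_def if_P[OF True] by (intro ratfun_eval_intros assms)
next
  case False
  show ?thesis unfolding regular_term_def if_not_P[OF False] by (intro ratfun_eval_intros assms)
qed

section \<open>From zeros at roots of unity to divisibility by the cyclotomic polynomial\<close>

text \<open>Cross-multiplying the given fraction with the reduced one and evaluating at
  \<open>z\<close> leaves the reduced numerator times a nonzero value equal to 0.\<close>

lemma numerator_root:
  assumes "ratfun_eval z A 0"
  shows "int_poly_eval z (fst (quot_of_fract A)) = 0"
proof -
  obtain n d where nd: "A = to_fract n / to_fract d" "int_poly_eval z d \<noteq> 0" "d \<noteq> 0"
      "0 = int_poly_eval z n / int_poly_eval z d"
    using assms by (rule ratfun_evalE)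
  let ?N = "fst (quot_of_fract A)" and ?D = "snd (quot_of_fract A)"
  have "A = to_fract ?N / to_fract ?D" by (simp flip: Fract_conv_to_fract)
  hence "to_fract n * to_fract ?D = to_fract ?N * to_fract d"
    using nd(1,3) by (simp add: frac_eq_eq)
  hence "n * ?D = ?N * d" by (simp flip: to_fract_mult)
  hence "int_poly_eval z n * int_poly_eval z ?D = int_poly_eval z ?N * int_poly_eval z d"
    by (metis int_poly_eval_simps(2))
  thus ?thesis using nd(2,4) by simp
qed

lemma prod_linear_dvd:
  fixes p :: "'a::field poly"
  assumes "finite S" "\<And>x. x \<in> S \<Longrightarrow> poly p x = 0"
  shows "(\<Prod>x\<in>S. [:- x, 1:]) dvd p"
  using assms
proof (induction S rule: finite_induct)
  case (insert a S)
  then obtain r where r: "p = (\<Prod>x\<in>S. [:- x, 1:]) * r" by (auto elim: dvdE)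
  have "poly (\<Prod>x\<in>S. [:- x, 1:]) a \<noteq> 0" using insert.hyps by (auto simp: poly_prod prod_zero_iff)
  moreover have "poly p a = 0" using insert.prems by simp
  ultimately have "poly r a = 0" unfolding r by simp
  hence "[:- a, 1:] dvd r" by (simp add: poly_eq_0_iff_dvd)
  thus ?case
    unfolding r prod.insert[OF insert.hyps] mult.commute[of _ r] by (intro mult_dvd_mono dvd_refl)
qed simp

text \<open>Divisibility holds over the complex numbers, where the cyclotomic polynomial is a
  product of distinct linear factors. Being monic, it has an integral quotient.\<close>

lemma cyclotomic_dvd:
  assumes n: "n > 0" and P: "\<And>z. z \<in> primitive_roots_unity n \<Longrightarrow> int_poly_eval z P = 0"
  shows "cyclotomic n dvd P"
proof -
  let ?h = "map_poly of_int :: int poly \<Rightarrow> complex poly"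
  have "?h (cyclotomic n) dvd ?h P"
    unfolding of_int_cyclotomic[OF n]
    using P by (intro prod_linear_dvd finite_primitive_roots_unity n) (simp add: int_poly_eval_def)
  then obtain C where C: "?h P = C * ?h (cyclotomic n)" by (metis dvdE mult.commute)
  have "lead_coeff (?h (cyclotomic n)) = 1"
    unfolding of_int_cyclotomic[OF n] by (simp add: lead_coeff_prod)
  moreover have "degree (?h (cyclotomic n)) = degree (cyclotomic n)" by (rule degree_map_poly) auto
  ultimately have "lead_coeff (cyclotomic n) = 1" by (simp add: coeff_map_poly)
  from int_poly_dvd_of_int[OF C this] obtain S where "?h S = C" by blast
  hence "?h P = ?h (S * cyclotomic n)" using C by (simp add: map_poly_of_int_mult)
  hence "P = S * cyclotomic n" by (rule injD[OF inj_map_poly_of_int])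
  thus ?thesis by simp
qed

lemma q_indet_power_neq_1:
  assumes "j > 0"
  shows "\<q> ^ j \<noteq> 1"
proof
  assume "\<q> ^ j = 1"
  moreover have "\<q> ^ j = to_fract ([:0, 1:] ^ j)" by (induction j) (simp_all add: q_indet_def del: mult_pCons_left flip: to_fract_mult)
  ultimately have "[:0, 1:] ^ j = (1 :: int poly)" using to_fract_eq_iff[of "[:0, 1:] ^ j" "1 :: int poly"] by simp
  hence "degree ([:0, 1:] ^ j :: int poly) = 0" by simp
  thus False using assms by (simp add: degree_power_eq)
qed

theorem theorem8p1:
  fixes n :: nat
  assumes "n > 0"
    and "n mod 8 = 5 \<or> n mod 8 = 7"
  shows "ratfun_cong
    (\<Sum>k = 0..(n - 1) div 2.
      q_int (10 * k + 2)
      * ((qpoch \<q> \<q> (2 * k) * qpoch \<q> (\<q> ^ 2) (3 * k) * qpoch (\<q> ^ 2) (\<q> ^ 8) k)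
         / (qpoch2 (\<q> ^ 9) (\<q> ^ 8) (\<q> ^ 8) k * qpoch \<q> (\<q> ^ 2) (2 * k)
            * qpoch (\<q> ^ 5) (\<q> ^ 4) k * qpoch (\<q> ^ 2) (\<q> ^ 2) k))
      * \<q> ^ (2 * k))
    0 (cyclotomic n)" (is "ratfun_cong ?S 0 _")
proof -
  have q1: "\<q> \<noteq> 1" using q_indet_power_neq_1[of 1] by simp
  have q0: "\<q> \<noteq> 0" by (simp add: q_indet_def)
  have "q_int j = (1 - \<q> ^ j) / (1 - \<q>)" for j
    using q1 by (simp add: q_int_def sum_gp_strict)
  hence S: "?S = (\<Sum>k\<le>(n - 1) div 2. regular_term \<q> (\<q> ^ 2) k) / (1 - \<q>)"
    unfolding sum_divide_distrib atMost_atLeast0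
    by (simp only: summand_eq_regular_term[OF q_indet_power_neq_1 q0])
  have "int_poly_eval z (fst (quot_of_fract (?S - 0))) = 0" if z: "z \<in> primitive_roots_unity n" for z
  proof -
    have zn: "z ^ n = 1" using z by (simp add: primitive_roots_unity_def)
    have z0: "z \<noteq> 0" using zn assms(1) by (auto simp: power_0_left)
    \<comment> \<open>Here \<open>n\<close> is not 1, so the factor \<open>1 / (1 - \<q>)\<close> is
      regular at \<open>z\<close>.\<close>
    have "z ^ 1 \<noteq> 1"
      unfolding root_of_unity_power_eq_1_iff[OF z assms(1)] using assms(2) by auto
    hence z1: "1 - z \<noteq> 0" by simp
    have "ratfun_eval z ?S ((\<Sum>k\<le>(n - 1) div 2. regular_term z (z ^ 2) k) / (1 - z))"
      unfolding S
      by (intro ratfun_eval_sum ratfun_eval_intros ratfun_eval_regular_term z0 z1 regular_denominators[OF z assms(2)]) simp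
    hence "ratfun_eval z (?S - 0) 0"
      unfolding sum_regular_term_root_of_unity[OF z assms(2)] by simp
    thus ?thesis by (rule numerator_root)
  qed
  thus ?thesis unfolding ratfun_cong_def by (intro cyclotomic_dvd assms(1))
qed

end
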